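(* Suppose that each $f_i:\mathbb{R}^{n\times r}\to\mathbb{R}$ ($i=1,\dots,m$) is $\tau$-weakly convex on $\mathbb{R}^{n\times r}$ for some $\tau\ge0$, and let $f=\frac1m\sum_{i=1}^m f_i$. Let $\mathcal{U}$ be any bounded open convex set that contains $\mathrm{St}(n,r)$, let $L>0$ be an upper bound on the Lipschitz constants of $f_1,\dots,f_m$ on $\mathcal{U}$, and let $0<\lambda<\frac{1}{2(L+\tau)}$. Let $\{X_k\}$ be the sequence generated by the Riemannian incremental subgradient method, with an arbitrary initialization $X_0\in\mathrm{St}(n,r)$, for minimizing $f$ over $\mathrm{St}(n,r)$. Let $C(m)=\frac13 m(m-1)(2m-1)$. Then the following hold: (a) If the constant stepsize $\gamma_k=\frac{1}{m\sqrt{T+1}}$, $k=0,1,\dots$, is chosen, with $T$ being the total number of iterations, then $$\min_{0\le k\le T}\Theta^2(X_k)\le \frac{2\big(f_\lambda(X_0)-\min f_\lambda\big)+\frac{L^2}{\lambda}+\frac{L^2(L+\tau)}{\lambda m^3}C(m)}{2\lambda\left(\frac{1}{2\lambda}-(L+\tau)\right)\sqrt{T+1}}.$$ (b) If the diminishing stepsizes $\gamma_k=\frac{1}{m\sqrt{k+1}}$, $k=0,1,\dots$, are chosen, then $$\min_{0\le k\le T}\Theta^2(X_k)\le \frac{2\big(f_\lambda(X_0)-\min f_\lambda\big)+\left(\frac{L^2}{\lambda}+\frac{L^2(L+\tau)}{\lambda m^3}C(m)\right)\big(\ln(T+1)+1\big)}{2\lambda\left(\frac{1}{2\lambda}-(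L+\tau)\right)\sqrt{T+1}}.$$
   Context: $\mathrm{St}(n,r)=\{X\in\mathbb{R}^{n\times r}: X^\top X=I_r\}$, with tangent space $T_X\mathrm{St}=\{\xi:\xi^\top X+X^\top\xi=0\}$; $\langle A,B\rangle=\mathrm{trace}(A^\top B)$, $\|A\|_F=\sqrt{\langle A,A\rangle}$. A function $h$ is $\tau$-weakly convex if $g:=h+\frac\tau2\|\cdot\|_F^2$ is convex; its Euclidean subdifferential is $\partial h(X)=\partial g(X)-\tau X$ ($\partial g$ the convex subdifferential), and its Riemannian subdifferential at $X\in\mathrm{St}(n,r)$ is $\partial_{\mathcal R}h(X)=\mathcal{P}_{T_X\mathrm{St}}(\partial h(X))$, with $\mathcal{P}_{T_X\mathrm{St}}(B)=B-\frac12X(B^\top X+X^\top B)$. The retraction is the polar one: $\mathrm{Retr}_X(\xi)=(X+\xi)(I_r+\xi^\top\xi)^{-1/2}$ for $X\in\mathrm{St}(n,r)$, $\xi\in T_X\mathrm{St}$. Riemannian incremental subgradient method with stepsizes $\gamma_k>0$: given $X_k\in\mathrm{St}(n,r)$, set $X_{k,0}=X_k$; for $i=1,\dots,m$ set $X_{k,i}=\mathrm{Retr}_{X_{k,i-1}}(-\gamma_k\widetilde\nabla_{\mathcal R}f_i(X_{k,i-1}))$, where $\widetilde\nabla_{\mathcal R}f_i(X_{k,i-1})$ is an arbitrary element of $\partial_{\mathcal R}f_i(X_{k,i-1})$; set $X_{k+1}=X_{k,m}$. Moreau envelope, proximal mapping and surrogate stationarity measure: for $X\in\mathrm{St}(n,r)$,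 $f_\lambda(X)=\min_{Y\in\mathrm{St}(n,r)}\{f(Y)+\frac1{2\lambda}\|Y-X\|_F^2\}$, $P_{\lambda f}(X)$ is any (arbitrarily chosen) element of $\mathrm{argmin}_{Y\in\mathrm{St}(n,r)}\{f(Y)+\frac1{2\lambda}\|Y-X\|_F^2\}$, and $\Theta(X)=\lambda^{-1}\|P_{\lambda f}(X)-X\|_F$. $\min f_\lambda$ denotes the minimum of $f_\lambda$ over $\mathrm{St}(n,r)$. *)

theory Defs
  imports "HOL-Analysis.Analysis"
begin

text \<open>
  An n-by-r real matrix is an element of \<open>real ^ 'r ^ 'n\<close> (the row index is the outer one), with
  \<open>n = CARD('n)\<close> and \<open>r = CARD('r)\<close>. The library's inner product and norm on this type are the
  Frobenius ones:
\<close>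

lemma inner_matrix_eq_trace:
  fixes A B :: "real ^ 'r ^ 'n"
  shows "A \<bullet> B = trace (transpose A ** B)"
  unfolding inner_vec_def trace_def matrix_matrix_mult_def transpose_def
  by (simp, rule sum.swap)

lemma norm_matrix_eq_frobenius:
  fixes A :: "real ^ 'r ^ 'n"
  shows "norm A = sqrt (trace (transpose A ** A))"
  by (simp add: norm_eq_sqrt_inner inner_matrix_eq_trace)

definition stiefel :: "(real ^ 'r ^ 'n) set" where
  "stiefel = {X. transpose X ** X = mat 1}"

definition tangent_space :: "real ^ 'r ^ 'n \<Rightarrow> (real ^ 'r ^ 'n) set" where
  "tangent_space X = {\<xi>. transpose \<xi> ** X + transpose X ** \<xi> = 0}"

definition proj_tangent :: "real ^ 'r ^ 'n \<Rightarrow> real ^ 'r ^ 'n \<Rightarrow> real ^ 'r ^ 'n" where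
  "proj_tangent X B = B - (1 / 2) *\<^sub>R (X ** (transpose B ** X + transpose X ** B))"

definition weakly_convex :: "real \<Rightarrow> ('a::real_inner \<Rightarrow> real) \<Rightarrow> bool" where
  "weakly_convex \<tau> h \<longleftrightarrow> convex_on UNIV (\<lambda>Y. h Y + \<tau> / 2 * (norm Y)\<^sup>2)"

definition convex_subdifferential :: "('a::real_inner \<Rightarrow> real) \<Rightarrow> 'a \<Rightarrow> 'a set" where
  "convex_subdifferential g X = {G. \<forall>Y. g Y \<ge> g X + G \<bullet> (Y - X)}"

definition weak_subdifferential :: "real \<Rightarrow> ('a::real_inner \<Rightarrow> real) \<Rightarrow> 'a \<Rightarrow> 'a set" where
  "weak_subdifferential \<tau> h X =
     (\<lambda>G. G - \<tau> *\<^sub>R X) ` convex_subdifferential (\<lambda>Y. h Y + \<tau> / 2 * (norm Y)\<^sup>2) X"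

definition riem_subdifferential ::
    "real \<Rightarrow> (real ^ 'r ^ 'n \<Rightarrow> real) \<Rightarrow> real ^ 'r ^ 'n \<Rightarrow> (real ^ 'r ^ 'n) set" where
  "riem_subdifferential \<tau> h X = proj_tangent X ` weak_subdifferential \<tau> h X"

definition sym_pos_def :: "real ^ 'r ^ 'r \<Rightarrow> bool" where
  "sym_pos_def S \<longleftrightarrow> transpose S = S \<and> (\<forall>v. v \<noteq> 0 \<longrightarrow> 0 < v \<bullet> (S *v v))"

text \<open>
  The power \<open>-1/2\<close> of a symmetric positive definite matrix: the unique symmetric positive definite
  square root of its inverse. The value is meaningful only for symmetric positive definite
  arguments, such as \<open>mat 1 + transpose \<xi> ** \<xi>\<close>.
\<close>

definition matrix_inv_sqrt :: "real ^ 'r ^ 'r \<Rightarrow> real ^ 'r ^ 'r" where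
  "matrix_inv_sqrt A = (THE S. sym_pos_def S \<and> S ** S = matrix_inv A)"

text \<open>The polar retraction, meant for \<open>X \<in> stiefel\<close> and \<open>\<xi> \<in> tangent_space X\<close>.\<close>

definition retr :: "real ^ 'r ^ 'n \<Rightarrow> real ^ 'r ^ 'n \<Rightarrow> real ^ 'r ^ 'n" where
  "retr X \<xi> = (X + \<xi>) ** matrix_inv_sqrt (mat 1 + transpose \<xi> ** \<xi>)"

text \<open>
  \<open>X\<close> is an outer sequence of the Riemannian incremental subgradient method for the components
  \<open>f 1, ..., f m\<close> with stepsizes \<open>\<gamma>\<close>; \<open>Z k i\<close> is the \<open>i\<close>-th inner iterate of the \<open>k\<close>-th outer step
  and \<open>G k i\<close> is the Riemannian subgradient used to compute it.
\<close>

definition riem_incremental_subgradient ::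
    "real \<Rightarrow> nat \<Rightarrow> (nat \<Rightarrow> real ^ 'r ^ 'n \<Rightarrow> real) \<Rightarrow> (nat \<Rightarrow> real) \<Rightarrow> (nat \<Rightarrow> real ^ 'r ^ 'n) \<Rightarrow> bool"
  where
  "riem_incremental_subgradient \<tau> m f \<gamma> X \<longleftrightarrow>
     X 0 \<in> stiefel \<and> (\<forall>k. 0 < \<gamma> k) \<and>
     (\<exists>Z G. \<forall>k.
        Z k 0 = X k \<and>
        (\<forall>i\<in>{1..m}. G k i \<in> riem_subdifferential \<tau> (f i) (Z k (i - 1)) \<and>
                    Z k i = retr (Z k (i - 1)) (- \<gamma> k *\<^sub>R G k i)) \<and>
        X (Suc k) = Z k m)"

definition average :: "nat \<Rightarrow> (nat \<Rightarrow> 'a \<Rightarrow> real) \<Rightarrow> 'a \<Rightarrow> real" where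
  "average m f Y = (1 / real m) * (\<Sum>i=1..m. f i Y)"

text \<open>The least element of the set of values; it exists in every use below, where a continuous
  function is minimised over the compact set \<open>stiefel\<close>.\<close>

definition minimum_on :: "('a \<Rightarrow> real) \<Rightarrow> 'a set \<Rightarrow> real" where
  "minimum_on h S = (LEAST v. v \<in> h ` S)"

definition prox_objective ::
    "real \<Rightarrow> (real ^ 'r ^ 'n \<Rightarrow> real) \<Rightarrow> real ^ 'r ^ 'n \<Rightarrow> real ^ 'r ^ 'n \<Rightarrow> real" where
  "prox_objective lam f X Y = f Y + 1 / (2 * lam) * (norm (Y - X))\<^sup>2"

definition moreau_envelope ::
    "real \<Rightarrow> (real ^ 'r ^ 'n \<Rightarrow> real) \<Rightarrow> real ^ 'r ^ 'n \<Rightarrow> real" where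
  "moreau_envelope lam f X = minimum_on (prox_objective lam f X) stiefel"

text \<open>\<open>P\<close> selects, for every point of the Stiefel manifold, one element of the proximal argmin.\<close>

definition is_prox_map ::
    "real \<Rightarrow> (real ^ 'r ^ 'n \<Rightarrow> real) \<Rightarrow> (real ^ 'r ^ 'n \<Rightarrow> real ^ 'r ^ 'n) \<Rightarrow> bool" where
  "is_prox_map lam f P \<longleftrightarrow>
     (\<forall>X\<in>stiefel. is_arg_min (prox_objective lam f X) (\<lambda>Y. Y \<in> stiefel) (P X))"

definition stationarity ::
    "real \<Rightarrow> (real ^ 'r ^ 'n \<Rightarrow> real ^ 'r ^ 'n) \<Rightarrow> real ^ 'r ^ 'n \<Rightarrow> real" where
  "stationarity lam P X = (1 / lam) * norm (P X - X)"

definition C_const :: "nat \<Rightarrow> real" where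
  "C_const m = (1 / 3) * real m * (real m - 1) * (2 * real m - 1)"

end

theory Submission
  imports Defs
begin

text \<open>
  The method is analysed as if it were an incremental subgradient method over a Euclidean
  convex set. Two facts make this possible, although the Stiefel manifold is not convex.

  The first is a subgradient inequality on the manifold (\<open>riem_subgradient_inequality\<close>). Replacing a
  Euclidean subgradient by its tangential part changes the linear term of the inequality by the
  pairing of the normal part with \<open>Y - X\<close>. For two points of the manifold this pairing is of second
  order in \<open>Y - X\<close>, so the inequality survives with the weak convexity constant \<open>\<tau>\<close> raised to \<open>L + \<tau>\<close>.

  The second is that the retracted point is at least as close to every point of the manifold as the
  tangent step is (\<open>norm_retr_diff_le\<close>). It is the orthonormal polar factor of \<open>X + \<xi>\<close>, and for a
  tangent \<open>\<xi>\<close> the positive factor \<open>H\<close> satisfies \<open>H \<ge> I\<close>, since \<open>H\<^sup>2 = I + \<xi>\<^sup>T \<xi>\<close>. The square root behind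
  the polar factor is constructed by the Banach fixed point theorem.

  With these, the squared distance to a given point \<open>Y\<close> of the manifold obeys along one pass the
  usual recursion of the incremental subgradient method (\<open>incremental_pass\<close>). After \<open>j\<close> steps of size
  \<open>c\<close> the inner iterate has moved by at most \<open>j c L\<close>. This drift costs \<open>\<Sum>j<m. 2 j\<^sup>2\<close>, which is
  \<open>C_const m\<close>, in the curvature term. Choosing \<open>Y\<close> as the proximal point of the current iterate
  turns the recursion into a decrease of the Moreau envelope by a multiple of the squared
  stationarity measure, up to terms of order two and three in the stepsize
  (\<open>moreau_envelope_descent\<close>). Both rates then follow by telescoping, from
  \<open>\<Sum>k\<le>T. 1 / sqrt (k + 1) \<ge> sqrt (T + 1)\<close> and the logarithmic bound for harmonic sums.
\<close>

section \<open>Matrix products and the Frobenius inner product\<close>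

lemma row_matrix_mult:
  fixes A :: "real ^ 'k ^ 'n" and B :: "real ^ 'l ^ 'k"
  shows "(A ** B) $ i = A $ i v* B"
  by (simp add: vec_eq_iff matrix_matrix_mult_def vector_matrix_mult_def mult.commute)

lemma norm_matrix_power2_rows:
  fixes A :: "real ^ 'k ^ 'n"
  shows "(norm A)\<^sup>2 = (\<Sum>i\<in>UNIV. (norm (A $ i))\<^sup>2)"
  by (simp add: norm_vec_def L2_set_def sum_nonneg)

lemma norm_transpose_matrix: "norm (transpose A) = norm (A :: real ^ 'k ^ 'n)"
proof -
  have "transpose A \<bullet> transpose A = A \<bullet> A"
    unfolding inner_matrix_eq_trace transpose_transpose by (rule trace_mul_sym)
  then show ?thesis
    by (simp add: norm_eq_sqrt_inner)
qed

text \<open>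
  The product acts on the rows of the left factor. Bounding the Frobenius norm of the left factor by
  the operator norm of the right one, and not by its Frobenius norm, is what makes the iteration for
  the square root below a contraction in any dimension.
\<close>

lemma norm_matrix_mult_le_operator_bound:
  fixes A :: "real ^ 'k ^ 'n" and B :: "real ^ 'l ^ 'k"
  assumes "0 \<le> c" and "\<And>v. norm (v v* B) \<le> c * norm v"
  shows "norm (A ** B) \<le> c * norm A"
proof (rule power2_le_imp_le)
  have "(norm (A ** B))\<^sup>2 \<le> (\<Sum>i\<in>UNIV. (c * norm (A $ i))\<^sup>2)"
    unfolding norm_matrix_power2_rows row_matrix_mult
    using assms by (intro sum_mono power_mono) auto
  also have "\<dots> = (c * norm A)\<^sup>2"
    by (simp add: power_mult_distrib norm_matrix_power2_rows sum_distrib_left)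
  finally show "(norm (A ** B))\<^sup>2 \<le> (c * norm A)\<^sup>2" .
qed (use assms in simp)

lemma norm_matrix_vector_mult_le:
  fixes A :: "real ^ 'k ^ 'n"
  shows "norm (A *v x) \<le> norm A * norm x"
proof (rule power2_le_imp_le)
  have "(norm (A *v x))\<^sup>2 = (\<Sum>i\<in>UNIV. (A $ i \<bullet> x)\<^sup>2)"
    by (simp add: norm_vec_def L2_set_def sum_nonneg matrix_vector_mul_component)
  also have "\<dots> \<le> (\<Sum>i\<in>UNIV. (norm (A $ i))\<^sup>2 * (norm x)\<^sup>2)"
    by (intro sum_mono) (metis Cauchy_Schwarz_ineq power2_norm_eq_inner)
  also have "\<dots> = (norm A * norm x)\<^sup>2"
    by (simp add: power_mult_distrib norm_matrix_power2_rows sum_distrib_right)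
  finally show "(norm (A *v x))\<^sup>2 \<le> (norm A * norm x)\<^sup>2" .
qed simp

lemma norm_matrix_mult_le:
  fixes A :: "real ^ 'k ^ 'n" and B :: "real ^ 'l ^ 'k"
  shows "norm (A ** B) \<le> norm A * norm B"
proof -
  have "norm (v v* B) \<le> norm B * norm v" for v
    using norm_matrix_vector_mult_le[of "transpose B" v] by (simp add: norm_transpose_matrix)
  then show ?thesis
    using norm_matrix_mult_le_operator_bound[of "norm B" B A] by (simp add: mult.commute)
qed

text \<open>
  Bilinearity yields at once the distributive laws and the continuity of the matrix product.
\<close>

lemma bounded_bilinear_matrix_mult:
  "bounded_bilinear ((**) :: real ^ 'k ^ 'n \<Rightarrow> real ^ 'l ^ 'k \<Rightarrow> real ^ 'l ^ 'n)"
proof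
  show "\<exists>K. \<forall>(a :: real ^ 'k ^ 'n) (b :: real ^ 'l ^ 'k). norm (a ** b) \<le> norm a * norm b * K"
    by (intro exI[of _ 1]) (simp add: norm_matrix_mult_le)
qed (simp_all add: vec_eq_iff matrix_matrix_mult_def distrib_left distrib_right sum.distrib sum_distrib_left mult.assoc mult.left_commute)

lemmas matrix_mult_diff_left = bounded_bilinear.diff_left[OF bounded_bilinear_matrix_mult]
lemmas matrix_mult_diff_right = bounded_bilinear.diff_right[OF bounded_bilinear_matrix_mult]
lemmas matrix_mult_add_left = bounded_bilinear.add_left[OF bounded_bilinear_matrix_mult]
lemmas matrix_mult_add_right = bounded_bilinear.add_right[OF bounded_bilinear_matrix_mult]
lemmas matrix_mult_scaleR_left = bounded_bilinear.scaleR_left[OF bounded_bilinear_matrix_mult]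
lemmas matrix_mult_scaleR_right = bounded_bilinear.scaleR_right[OF bounded_bilinear_matrix_mult]

lemmas matrix_mult_algebra =
  matrix_mult_diff_left matrix_mult_diff_right matrix_mult_add_left matrix_mult_add_right
  matrix_mult_scaleR_left matrix_mult_scaleR_right

lemma bounded_linear_transpose:
  "bounded_linear (transpose :: real ^ 'k ^ 'n \<Rightarrow> real ^ 'n ^ 'k)"
proof
  show "\<exists>K. \<forall>A :: real ^ 'k ^ 'n. norm (transpose A) \<le> norm A * K"
    by (intro exI[of _ 1]) (simp add: norm_transpose_matrix)
qed (simp_all add: vec_eq_iff transpose_def)

lemmas transpose_add = linear_add[OF bounded_linear.linear[OF bounded_linear_transpose]]
lemmas transpose_diff = linear_diff[OF bounded_linear.linear[OF bounded_linear_transpose]]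

lemmas transpose_algebra = transpose_add transpose_diff transpose_scalar matrix_transpose_mul

lemma inner_matrix_mult_left:
  fixes A :: "real ^ 'k ^ 'n" and B :: "real ^ 'l ^ 'k"
  shows "(A ** B) \<bullet> C = B \<bullet> (transpose A ** C)"
  by (simp add: inner_matrix_eq_trace matrix_transpose_mul matrix_mul_assoc)

lemma inner_transpose_matrix:
  fixes A :: "real ^ 'k ^ 'n"
  shows "transpose A \<bullet> B = A \<bullet> transpose B"
  unfolding inner_matrix_eq_trace
  by (metis inner_commute inner_matrix_eq_trace trace_mul_sym transpose_transpose)

lemma inner_matrix_mult_right:
  fixes A :: "real ^ 'k ^ 'n" and B :: "real ^ 'l ^ 'k"
  shows "(A ** B) \<bullet> C = A \<bullet> (C ** transpose B)"
proof -
  have "(A ** B) \<bullet> C = (transpose B ** transpose A) \<bullet> transpose C"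
    by (metis inner_transpose_matrix matrix_transpose_mul transpose_transpose)
  also have "\<dots> = transpose A \<bullet> (B ** transpose C)"
    by (simp add: inner_matrix_mult_left)
  also have "\<dots> = A \<bullet> (C ** transpose B)"
    by (simp add: inner_transpose_matrix matrix_transpose_mul)
  finally show ?thesis .
qed

text \<open>
  The inner product is the sum of the quadratic form of \<open>D\<close> over the rows of \<open>A\<close>.
\<close>

lemma inner_matrix_mult_psd_nonneg:
  fixes A :: "real ^ 'k ^ 'n" and D :: "real ^ 'k ^ 'k"
  assumes "\<And>v. 0 \<le> v \<bullet> (D *v v)"
  shows "0 \<le> (A ** D) \<bullet> A"
  unfolding inner_vec_def[of "A ** D"] row_matrix_mult dot_lmul_matrix
  by (intro sum_nonneg assms)

lemma inner_matrix_mult_pos_def_pos: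
  fixes A :: "real ^ 'k ^ 'n" and D :: "real ^ 'k ^ 'k"
  assumes "\<And>v. v \<noteq> 0 \<Longrightarrow> 0 < v \<bullet> (D *v v)" and "A \<noteq> 0"
  shows "0 < (A ** D) \<bullet> A"
proof -
  obtain i where "A $ i \<noteq> 0"
    using assms(2) by (auto simp: vec_eq_iff)
  have "0 \<le> v \<bullet> (D *v v)" for v
    using assms(1)[of v] by (cases "v = 0") auto
  then show ?thesis
    unfolding inner_vec_def[of "A ** D"] row_matrix_mult dot_lmul_matrix
    using \<open>A $ i \<noteq> 0\<close> assms(1) by (intro sum_pos2[of _ i]) auto
qed

lemma inner_symmetric_matrix_vector:
  fixes S :: "real ^ 'k ^ 'k"
  assumes "transpose S = S"
  shows "(S *v x) \<bullet> y = x \<bullet> (S *v y)"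
  by (metis assms dot_lmul_matrix transpose_matrix_vector)

section \<open>The positive definite square root\<close>

text \<open>
  If \<open>S\<^sup>2 = T\<^sup>2\<close> then \<open>D = S - T\<close> satisfies \<open>D S + T D = 0\<close>. Pairing this with \<open>D\<close> gives a sum of
  two quadratic forms that are positive unless \<open>D = 0\<close>.
\<close>

lemma sym_pos_def_sqrt_unique:
  assumes S: "sym_pos_def S" and T: "sym_pos_def T" and eq: "S ** S = T ** T"
  shows "S = T"
proof (rule ccontr)
  let ?D = "S - T"
  assume "S \<noteq> T"
  then have nz: "?D \<noteq> 0" "transpose ?D \<noteq> 0"
    using S T by (auto simp: transpose_diff sym_pos_def_def)
  have symm: "transpose S = S" "transpose T = T" "transpose ?D = ?D"
    using S T by (auto simp: transpose_diff sym_pos_def_def)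
  have "?D ** S + T ** ?D = 0"
    by (simp add: matrix_mult_algebra eq)
  then have "(?D ** S) \<bullet> ?D + (T ** ?D) \<bullet> ?D = 0"
    by (metis inner_add_left inner_zero_left)
  moreover have "(T ** ?D) \<bullet> ?D = (?D ** T) \<bullet> ?D"
    by (metis inner_commute inner_transpose_matrix matrix_transpose_mul symm(2,3) )
  moreover have "0 < (?D ** S) \<bullet> ?D" "0 < (?D ** T) \<bullet> ?D"
    using S T nz by (auto intro!: inner_matrix_mult_pos_def_pos simp: sym_pos_def_def)
  ultimately show False
    by simp
qed

text \<open>
  Writing the root as \<open>I - Y\<close>, the equation \<open>(I - Y)\<^sup>2 = I - C\<close> becomes the fixed point equation
  \<open>Y = (C + Y\<^sup>2) / 2\<close>. Its right-hand side maps the symmetric matrices of operator norm at most \<open>c\<close> to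
  themselves and contracts the Frobenius distance there by the factor \<open>c\<close>.
\<close>

lemma sym_pos_def_sqrt_exists_near_identity:
  fixes C :: "real ^ 'r ^ 'r"
  assumes sym: "transpose C = C" and c: "0 \<le> c" "c < 1"
    and bound: "\<And>v. norm (C *v v) \<le> c * norm v"
  shows "\<exists>S. sym_pos_def S \<and> S ** S = mat 1 - C"
proof -
  define K where "K = {Y :: real ^ 'r ^ 'r. transpose Y = Y \<and> (\<forall>v. norm (Y *v v) \<le> c * norm v)}"
  define \<phi> where "\<phi> Y = (1 / 2) *\<^sub>R (C + Y ** Y)" for Y :: "real ^ 'r ^ 'r"
  have right: "norm (A ** Y) \<le> c * norm A" if "Y \<in> K" for A Y :: "real ^ 'r ^ 'r"
    using that c unfolding K_def
    by (intro norm_matrix_mult_le_operator_bound) (auto, metis transpose_matrix_vector)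
  have left: "norm (Y ** A) \<le> c * norm A" if "Y \<in> K" for A Y :: "real ^ 'r ^ 'r"
    using right[OF that, of "transpose A"] that unfolding K_def
    by (metis (mono_tags, lifting) matrix_transpose_mul mem_Collect_eq norm_transpose_matrix)
  have "closed K"
  proof -
    have "closed {Y :: real ^ 'r ^ 'r. transpose Y = Y}"
      by (intro closed_Collect_eq continuous_on_id
          bounded_linear.continuous_on[OF bounded_linear_transpose])
    moreover have "closed {Y :: real ^ 'r ^ 'r. norm (Y *v v) \<le> c * norm v}" for v
    proof -
      have "bounded_linear (\<lambda>Y :: real ^ 'r ^ 'r. Y *v v)"
      proof
        show "\<exists>k. \<forall>Y :: real ^ 'r ^ 'r. norm (Y *v v) \<le> norm Y * k"
          using norm_matrix_vector_mult_le by blast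
      qed (simp_all add: matrix_vector_mult_add_rdistrib flip: scaleR_matrix_vector_assoc)
      from bounded_linear.continuous_on[OF this continuous_on_id] show ?thesis
        by (intro closed_Collect_le continuous_intros)
    qed
    ultimately have "closed ({Y :: real ^ 'r ^ 'r. transpose Y = Y} \<inter> (\<Inter>v. {Y. norm (Y *v v) \<le> c * norm v}))"
      by (intro closed_Int closed_INT) auto
    moreover have "K = {Y. transpose Y = Y} \<inter> (\<Inter>v. {Y. norm (Y *v v) \<le> c * norm v})"
      by (auto simp: K_def)
    ultimately show ?thesis
      by simp
  qed
  moreover have "0 \<in> K"
    using c by (simp add: K_def linear_0[OF bounded_linear.linear[OF bounded_linear_transpose]])
  moreover have "\<phi> ` K \<subseteq> K"
  proof clarify
    fix Y assume Y: "Y \<in> K"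
    have "norm (\<phi> Y *v v) \<le> c * norm v" for v
    proof -
      have "norm (Y *v (Y *v v)) \<le> c * norm (Y *v v)"
        using Y by (simp add: K_def)
      also have "\<dots> \<le> 1 * norm (Y *v v)"
        using c by (intro mult_right_mono) auto
      also have "\<dots> \<le> c * norm v"
        using Y by (simp add: K_def)
      finally have "norm (C *v v + Y *v (Y *v v)) \<le> 2 * (c * norm v)"
        using bound[of v] norm_triangle_ineq[of "C *v v" "Y *v (Y *v v)"] by linarith
      then show ?thesis
        by (simp add: \<phi>_def scaleR_matrix_vector_assoc[symmetric] matrix_vector_mult_add_rdistrib
            matrix_vector_mul_assoc)
    qed
    moreover have "transpose (\<phi> Y) = \<phi> Y"
      using Y sym by (simp add: K_def \<phi>_def transpose_algebra)
    ultimately show "\<phi> Y \<in> K"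
      by (simp add: K_def)
  qed
  moreover have "dist (\<phi> Y) (\<phi> Z) \<le> c * dist Y Z" if "Y \<in> K" "Z \<in> K" for Y Z
  proof -
    \<comment> \<open>The factorisation \<open>Y\<^sup>2 - Z\<^sup>2 = Y (Y - Z) + (Y - Z) Z\<close> also holds for noncommuting matrices.\<close>
    have "\<phi> Y - \<phi> Z = (1 / 2) *\<^sub>R (Y ** (Y - Z) + (Y - Z) ** Z)"
      by (simp add: \<phi>_def matrix_mult_algebra algebra_simps)
    then show ?thesis
      using left[OF that(1), of "Y - Z"] right[OF that(2), of "Y - Z"]
        norm_triangle_ineq[of "Y ** (Y - Z)" "(Y - Z) ** Z"]
      by (simp add: dist_norm)
  qed
  ultimately obtain Y where Y: "Y \<in> K" "\<phi> Y = Y"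
    using Banach_fix[of K c \<phi>] c by (auto simp: complete_eq_closed)
  then have "C + Y ** Y = 2 *\<^sub>R Y"
    by (metis \<phi>_def scaleR_half_double scaleR_right_distrib scaleR_2)
  then have "(mat 1 - Y) ** (mat 1 - Y) = mat 1 - C"
    by (simp add: matrix_mult_algebra algebra_simps scaleR_2)
  moreover have "sym_pos_def (mat 1 - Y)"
    unfolding sym_pos_def_def
  proof (intro conjI allI impI)
    show "transpose (mat 1 - Y) = mat 1 - Y"
      using Y by (simp add: K_def transpose_diff)
    fix v :: "real ^ 'r" assume "v \<noteq> 0"
    have "v \<bullet> (Y *v v) \<le> norm v * norm (Y *v v)"
      by (rule norm_cauchy_schwarz)
    also have "\<dots> \<le> norm v * (c * norm v)"
      using Y by (intro mult_left_mono) (auto simp: K_def)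
    also have "\<dots> < norm v * norm v"
      using c \<open>v \<noteq> 0\<close> by simp
    finally show "0 < v \<bullet> ((mat 1 - Y) *v v)"
      by (simp add: matrix_vector_mult_diff_rdistrib inner_diff_right power2_norm_eq_inner
          flip: power2_eq_square)
  qed
  ultimately show ?thesis
    by blast
qed

text \<open>
  The inverse \<open>B\<close> of \<open>I + M\<close> is \<open>I - M B\<close>, and \<open>M B\<close> has eigenvalues \<open>\<mu> / (1 + \<mu>) < 1\<close>, so the
  fixed point construction of the square root applies to \<open>B\<close>. The resulting root satisfies \<open>S\<^sup>2 = B\<close>
  with \<open>B\<close> nonexpansive, hence it is nonexpansive too.
\<close>

lemma matrix_inv_sqrt_one_plus_psd:
  fixes M :: "real ^ 'r ^ 'r"
  assumes sym: "transpose M = M" and psd: "\<And>v. 0 \<le> v \<bullet> (M *v v)"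
  defines "S \<equiv> matrix_inv_sqrt (mat 1 + M)"
  shows "sym_pos_def S" "S ** (S ** (mat 1 + M)) = mat 1" "norm (S *v w) \<le> norm w"
proof -
  define A where "A = mat 1 + M"
  define B where "B = matrix_inv A"
  have expand: "(norm v)\<^sup>2 + (norm (M *v v))\<^sup>2 \<le> (norm (A *v v))\<^sup>2" for v
    using psd[of v] by (simp add: A_def matrix_vector_mult_add_rdistrib power2_norm_eq_inner
        inner_add_left inner_add_right inner_commute)
  then have noncontr: "norm v \<le> norm (A *v v)" for v
    by (meson norm_ge_zero power2_le_imp_le le_add_same_cancel1 order_trans zero_le_power2)
  have "inj ((*v) A)"
    by (rule injI) (metis noncontr eq_iff_diff_eq_0 matrix_vector_mult_diff_distrib norm_le_zero_iff
        norm_zero)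
  then have "\<exists>A'. A ** A' = mat 1 \<and> A' ** A = mat 1"
    by (metis matrix_left_invertible_injective matrix_left_right_inverse)
  then have "A ** matrix_inv A = mat 1 \<and> matrix_inv A ** A = mat 1"
    unfolding matrix_inv_def by (rule someI_ex)
  then have AB: "A ** B = mat 1" and BA: "B ** A = mat 1"
    by (simp_all add: B_def)
  have "transpose A = A"
    by (simp add: A_def transpose_add sym)
  then have "A ** transpose B = mat 1"
    by (metis BA matrix_transpose_mul transpose_mat)
  then have symB: "transpose B = B"
    by (metis BA matrix_mul_assoc matrix_mul_lid matrix_mul_rid)
  have AB_v: "A *v (B *v v) = v" for v
    by (simp add: matrix_vector_mul_assoc AB)
  have C_v: "(mat 1 - B) *v v = M *v (B *v v)" for v
  proof -
    have "B *v v + M *v (B *v v) = v"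
      using AB_v[of v] by (simp add: A_def matrix_vector_mult_add_rdistrib)
    then show ?thesis
      by (simp add: matrix_vector_mult_diff_rdistrib algebra_simps)
  qed
  \<comment> \<open>With \<open>w = B v\<close> one has \<open>|v|\<^sup>2 \<ge> |w|\<^sup>2 + |M w|\<^sup>2\<close> and \<open>|M w| \<le> K |w|\<close>, where \<open>K = |M|\<close>. Thus
    \<open>|M w| \<le> c |v|\<close> with \<open>c\<^sup>2 = K\<^sup>2 / (1 + K\<^sup>2)\<close>.\<close>
  define c where "c = sqrt ((norm M)\<^sup>2 / (1 + (norm M)\<^sup>2))"
  have c: "0 \<le> c" "c < 1"
    by (auto simp: c_def add_pos_nonneg divide_simps real_sqrt_lt_1_iff)
  have "norm ((mat 1 - B) *v v) \<le> c * norm v" for v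
  proof -
    let ?w = "B *v v" and ?K = "(norm M)\<^sup>2"
    have "(norm (M *v ?w))\<^sup>2 \<le> ?K * (norm ?w)\<^sup>2"
      by (metis norm_ge_zero norm_matrix_vector_mult_le power_mono power_mult_distrib)
    moreover have "?K * ((norm ?w)\<^sup>2 + (norm (M *v ?w))\<^sup>2) \<le> ?K * (norm v)\<^sup>2"
      using expand[of ?w] by (intro mult_left_mono) (simp_all add: AB_v)
    ultimately have "(1 + ?K) * (norm (M *v ?w))\<^sup>2 \<le> ?K * (norm v)\<^sup>2"
      by (simp add: algebra_simps)
    then have "(norm (M *v ?w))\<^sup>2 \<le> ?K / (1 + ?K) * (norm v)\<^sup>2"
      by (simp add: pos_le_divide_eq add_pos_nonneg mult.commute)
    also have "\<dots> = (c * norm v)\<^sup>2"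
      by (simp add: c_def power_mult_distrib)
    finally show ?thesis
      using c by (simp add: C_v power2_le_iff_abs_le)
  qed
  moreover have "transpose (mat 1 - B) = mat 1 - B"
    by (simp add: transpose_diff symB)
  ultimately obtain S' where S': "sym_pos_def S'" "S' ** S' = B"
    using sym_pos_def_sqrt_exists_near_identity[of "mat 1 - B" c] c by auto
  then have "S = S'"
    unfolding S_def matrix_inv_sqrt_def A_def[symmetric] B_def[symmetric]
    by (intro the_equality) (auto intro: sym_pos_def_sqrt_unique)
  then have S: "sym_pos_def S" "S ** S = B"
    using S' by auto
  show "sym_pos_def S"
    by (rule S)
  show "S ** (S ** (mat 1 + M)) = mat 1"
    using BA by (simp add: A_def S matrix_mul_assoc)
  have "(norm (S *v w))\<^sup>2 = w \<bullet> (B *v w)"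
    using S by (simp add: power2_norm_eq_inner inner_symmetric_matrix_vector sym_pos_def_def
        matrix_vector_mul_assoc)
  also have "\<dots> \<le> norm w * norm (B *v w)"
    by (rule norm_cauchy_schwarz)
  also have "\<dots> \<le> norm w * norm w"
    using noncontr[of "B *v w"] by (intro mult_left_mono) (simp_all add: AB_v)
  finally show "norm (S *v w) \<le> norm w"
    using power2_le_imp_le[of "norm (S *v w)" "norm w"] by (simp add: power2_eq_square)
qed

section \<open>The polar retraction\<close>

text \<open>
  Tangency makes the cross terms of \<open>(X + \<xi>)\<^sup>T (X + \<xi>)\<close> vanish, so this Gram matrix is \<open>I + \<xi>\<^sup>T \<xi>\<close>.
  Hence the retraction is the orthonormal polar factor of \<open>X + \<xi>\<close>. Its positive factor \<open>H\<close> is the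
  inverse of the nonexpansive matrix \<open>S = (I + \<xi>\<^sup>T \<xi>) ^ (-1/2)\<close>, which gives \<open>H \<ge> I\<close>.
\<close>

lemma retr_polar_decomposition:
  fixes X \<xi> :: "real ^ 'r ^ 'n"
  assumes X: "X \<in> stiefel" and \<xi>: "\<xi> \<in> tangent_space X"
  obtains H where "retr X \<xi> \<in> stiefel" "X + \<xi> = retr X \<xi> ** H" "transpose H = H"
    "\<And>v. 0 \<le> v \<bullet> ((H - mat 1) *v v)"
proof -
  define M where "M = transpose \<xi> ** \<xi>"
  define S where "S = matrix_inv_sqrt (mat 1 + M)"
  define H where "H = S ** (mat 1 + M)"
  have "transpose M = M"
    by (simp add: M_def matrix_transpose_mul)
  moreover have "0 \<le> v \<bullet> (M *v v)" for v
  proof -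
    have "v \<bullet> (M *v v) = (\<xi> *v v) \<bullet> (\<xi> *v v)"
      by (metis M_def dot_lmul_matrix inner_commute matrix_vector_mul_assoc transpose_matrix_vector)
    then show ?thesis
      by simp
  qed
  ultimately have S: "sym_pos_def S" and SH: "S ** H = mat 1"
    and contr: "norm (S *v w) \<le> norm w" for w
    unfolding S_def H_def using matrix_inv_sqrt_one_plus_psd[of M] by auto
  have symS: "transpose S = S"
    using S by (simp add: sym_pos_def_def)
  have HS: "H ** S = mat 1"
    using SH by (simp add: matrix_left_right_inverse)
  have "transpose H ** S = mat 1"
    by (metis SH matrix_transpose_mul symS transpose_mat)
  then have symH: "transpose H = H"
    by (metis SH matrix_mul_assoc matrix_mul_lid matrix_mul_rid)
  have retr: "retr X \<xi> = (X + \<xi>) ** S"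
    by (simp add: retr_def S_def M_def)
  have "transpose (X + \<xi>) ** (X + \<xi>) = mat 1 + M"
  proof -
    have "transpose (X + \<xi>) ** (X + \<xi>)
        = transpose X ** X + (transpose \<xi> ** X + transpose X ** \<xi>) + transpose \<xi> ** \<xi>"
      by (simp add: transpose_add matrix_mult_add_left matrix_mult_add_right)
    then show ?thesis
      using X \<xi> by (simp add: stiefel_def tangent_space_def M_def)
  qed
  then have "transpose (retr X \<xi>) ** retr X \<xi> = S ** (mat 1 + M) ** S"
    unfolding retr by (metis matrix_mul_assoc matrix_transpose_mul symS)
  then have "retr X \<xi> \<in> stiefel"
    using HS by (simp add: stiefel_def H_def)
  moreover have "X + \<xi> = retr X \<xi> ** H"
    unfolding retr by (metis SH matrix_mul_assoc matrix_mul_rid)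
  moreover have "0 \<le> v \<bullet> ((H - mat 1) *v v)" for v
  proof -
    define w where "w = H *v v"
    have v: "v = S *v w"
      by (simp add: w_def matrix_vector_mul_assoc SH)
    \<comment> \<open>In terms of \<open>w = H v\<close> the claim is \<open>|S w|\<^sup>2 \<le> \<langle>w, S w\<rangle>\<close>, that is \<open>S\<^sup>2 \<le> S\<close>. It follows from
      positivity of \<open>S\<close> at the vector \<open>w - S w\<close> and nonexpansiveness of \<open>S\<close> at \<open>S w\<close>.\<close>
    let ?u = "w - S *v w"
    have "0 \<le> ?u \<bullet> (S *v ?u)"
      using S by (cases "?u = 0") (auto simp: sym_pos_def_def less_imp_le)
    also have "\<dots> = w \<bullet> (S *v w) - 2 * ((S *v w) \<bullet> (S *v w)) + (S *v w) \<bullet> (S *v (S *v w))"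
      using inner_symmetric_matrix_vector[OF symS, of w "S *v w"]
      by (simp add: matrix_vector_mult_diff_distrib inner_diff_left inner_diff_right)
    also have "(S *v w) \<bullet> (S *v (S *v w)) \<le> (S *v w) \<bullet> (S *v w)"
    proof -
      have "(S *v w) \<bullet> (S *v (S *v w)) \<le> norm (S *v w) * norm (S *v (S *v w))"
        by (rule norm_cauchy_schwarz)
      also have "\<dots> \<le> norm (S *v w) * norm (S *v w)"
        by (intro mult_left_mono contr) simp
      finally show ?thesis
        by (simp add: power2_norm_eq_inner flip: power2_eq_square)
    qed
    finally have "v \<bullet> v \<le> v \<bullet> w"
      by (simp add: v inner_commute)
    then show ?thesis
      by (simp add: matrix_vector_mult_diff_rdistrib inner_diff_right w_def)
  qed
  ultimately show thesis
    using symH that by blast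
qed

text \<open>
  Put \<open>D = H - I\<close>. For \<open>Q\<close> and \<open>Y\<close> with orthonormal columns, \<open>\<langle>Q - Y, Q D\<rangle>\<close> is half the quadratic
  form \<open>\<langle>(Q - Y) D, Q - Y\<rangle>\<close>, which is nonnegative. So moving from \<open>Q\<close> by \<open>Q D\<close> leads away from \<open>Y\<close>.
\<close>

lemma stiefel_polar_factor_closer:
  fixes Q Y :: "real ^ 'r ^ 'n"
  assumes Q: "Q \<in> stiefel" and Y: "Y \<in> stiefel"
    and sym: "transpose H = H" and psd: "\<And>v. 0 \<le> v \<bullet> ((H - mat 1) *v v)"
  shows "norm (Q - Y) \<le> norm (Q ** H - Y)"
proof (rule power2_le_imp_le)
  define D where "D = H - mat 1"
  have symD: "transpose D = D"
    by (simp add: D_def transpose_diff sym)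
  have "(Z ** D) \<bullet> Z = D \<bullet> mat 1" if "Z \<in> stiefel" for Z :: "real ^ 'r ^ 'n"
    using that by (simp add: inner_matrix_mult_left stiefel_def)
  then have "(Q ** D) \<bullet> Q = (Y ** D) \<bullet> Y"
    using Q Y by metis
  moreover have "(Y ** D) \<bullet> Q = (Q ** D) \<bullet> Y"
    using inner_matrix_mult_right[of Y D Q] by (simp add: symD inner_commute)
  ultimately have "2 * ((Q - Y) \<bullet> (Q ** D)) = ((Q - Y) ** D) \<bullet> (Q - Y)"
    by (simp add: matrix_mult_diff_left inner_diff_left inner_diff_right inner_commute)
  moreover have "0 \<le> ((Q - Y) ** D) \<bullet> (Q - Y)"
    using psd by (intro inner_matrix_mult_psd_nonneg) (simp add: D_def)
  ultimately have "0 \<le> (Q - Y) \<bullet> (Q ** D)"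
    by linarith
  moreover have "Q ** H - Y = (Q - Y) + Q ** D"
    by (simp add: D_def matrix_mult_diff_right)
  then have "(norm (Q ** H - Y))\<^sup>2
      = (norm (Q - Y))\<^sup>2 + 2 * ((Q - Y) \<bullet> (Q ** D)) + (norm (Q ** D))\<^sup>2"
    by (simp add: power2_norm_eq_inner inner_add_left inner_add_right inner_diff_left
        inner_diff_right inner_commute)
  ultimately show "(norm (Q - Y))\<^sup>2 \<le> (norm (Q ** H - Y))\<^sup>2"
    by simp
qed simp

lemma retr_in_stiefel:
  assumes "X \<in> stiefel" "\<xi> \<in> tangent_space X"
  shows "retr X \<xi> \<in> stiefel"
  using retr_polar_decomposition[OF assms] by blast

text \<open>
  This substitutes for the nonexpansiveness of the projection onto a convex set.
\<close>

lemma norm_retr_diff_le: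
  assumes "X \<in> stiefel" "\<xi> \<in> tangent_space X" "Y \<in> stiefel"
  shows "norm (retr X \<xi> - Y) \<le> norm (X + \<xi> - Y)"
  using retr_polar_decomposition[OF assms(1,2)] stiefel_polar_factor_closer[OF _ assms(3)] by metis

section \<open>Riemannian subgradients of weakly convex functions\<close>

lemma norm_stiefel_mult:
  fixes X :: "real ^ 'r ^ 'n" and A :: "real ^ 'l ^ 'r"
  assumes "X \<in> stiefel"
  shows "norm (X ** A) = norm A"
  using assms
  by (simp add: norm_eq_sqrt_inner inner_matrix_mult_left matrix_mul_assoc stiefel_def)

lemma inner_symmetric_part:
  fixes A S :: "real ^ 'r ^ 'r"
  assumes "transpose S = S"
  shows "S \<bullet> (A + transpose A) = 2 * (S \<bullet> A)"
  using assms by (simp add: inner_add_right flip: inner_transpose_matrix)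

lemma proj_tangent_in_tangent_space:
  fixes X B :: "real ^ 'r ^ 'n"
  assumes "X \<in> stiefel"
  shows "proj_tangent X B \<in> tangent_space X"
proof -
  define S where "S = transpose B ** X + transpose X ** B"
  have "transpose S = S"
    by (simp add: S_def transpose_algebra add.commute)
  moreover have "transpose X ** (X ** S) = S"
    using assms by (simp add: matrix_mul_assoc stiefel_def)
  moreover have "(S ** transpose X) ** X = S"
    using assms by (simp add: stiefel_def flip: matrix_mul_assoc)
  ultimately have "transpose (proj_tangent X B) ** X + transpose X ** proj_tangent X B
      = S - ((1 / 2) *\<^sub>R S + (1 / 2) *\<^sub>R S)"
    unfolding proj_tangent_def S_def[symmetric]
    by (simp add: transpose_algebra matrix_mult_algebra) (simp add: S_def)
  then show ?thesis
    by (simp add: tangent_space_def flip: scaleR_left_distrib)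
qed

text \<open>
  With \<open>S = B\<^sup>T X + X\<^sup>T B\<close>, Pythagoras gives the tangential part the squared norm \<open>|B|\<^sup>2 - |S|\<^sup>2 / 4\<close>.
\<close>

lemma norm_proj_tangent_le:
  fixes X B :: "real ^ 'r ^ 'n"
  assumes "X \<in> stiefel"
  shows "norm (proj_tangent X B) \<le> norm B"
proof (rule power2_le_imp_le)
  define S where "S = transpose B ** X + transpose X ** B"
  have symS: "transpose S = S"
    by (simp add: S_def transpose_algebra add.commute)
  have "S = transpose X ** B + transpose (transpose X ** B)"
    by (simp add: S_def transpose_algebra add.commute)
  then have "S \<bullet> S = 2 * (S \<bullet> (transpose X ** B))"
    using inner_symmetric_part[OF symS] by metis
  then have "(X ** S) \<bullet> B = S \<bullet> S / 2"
    by (simp add: inner_matrix_mult_left)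
  moreover have "(X ** S) \<bullet> (X ** S) = S \<bullet> S"
    using norm_stiefel_mult[OF assms, of S] by (simp flip: power2_norm_eq_inner)
  moreover have "proj_tangent X B = B - (1 / 2) *\<^sub>R (X ** S)"
    by (simp add: proj_tangent_def S_def)
  ultimately have "(norm (proj_tangent X B))\<^sup>2 = (norm B)\<^sup>2 - S \<bullet> S / 4"
    by (simp add: power2_norm_eq_inner inner_diff_left inner_diff_right inner_commute)
  then show "(norm (proj_tangent X B))\<^sup>2 \<le> (norm B)\<^sup>2"
    using inner_ge_zero[of S] by linarith
qed simp

text \<open>
  The normal part of \<open>B\<close> is \<open>X S / 2\<close> with \<open>S\<close> symmetric, so its pairing with \<open>Y - X\<close> only sees the
  symmetric part of \<open>X\<^sup>T Y - I\<close>. This symmetric part is \<open>- (Y - X)\<^sup>T (Y - X) / 2\<close> because both points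
  have orthonormal columns. Hence the pairing is quadratic in \<open>Y - X\<close>.
\<close>

lemma proj_tangent_remainder:
  fixes X Y B :: "real ^ 'r ^ 'n"
  assumes X: "X \<in> stiefel" and Y: "Y \<in> stiefel"
  shows "- (norm B * (norm (Y - X))\<^sup>2) / 2 \<le> (B - proj_tangent X B) \<bullet> (Y - X)"
proof -
  define S where "S = transpose B ** X + transpose X ** B"
  define W where "W = transpose (Y - X) ** (Y - X)"
  have symS: "transpose S = S" and symW: "transpose W = W"
    by (simp_all add: S_def W_def transpose_algebra add.commute)
  have W: "W = (mat 1 - transpose X ** Y) + transpose (mat 1 - transpose X ** Y)"
    using X Y by (simp add: W_def stiefel_def transpose_algebra matrix_mult_algebra)
  have "S = transpose X ** B + transpose (transpose X ** B)"
    by (simp add: S_def transpose_algebra add.commute)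
  then have "W \<bullet> S = 2 * (W \<bullet> (transpose X ** B))"
    using inner_symmetric_part[OF symW] by metis
  also have "W \<bullet> (transpose X ** B) = (X ** W) \<bullet> B"
    by (simp add: inner_matrix_mult_left)
  also have "(X ** W) \<bullet> B \<le> norm (X ** W) * norm B"
    by (rule norm_cauchy_schwarz)
  also have "norm (X ** W) \<le> norm (Y - X) * norm (Y - X)"
    unfolding norm_stiefel_mult[OF X] W_def
    using norm_matrix_mult_le[of "transpose (Y - X)" "Y - X"] by (simp add: norm_transpose_matrix)
  finally have "W \<bullet> S \<le> 2 * (norm B * (norm (Y - X))\<^sup>2)"
    by (simp add: mult_right_mono power2_eq_square mult.commute)
  moreover have "W \<bullet> S = - 2 * ((X ** S) \<bullet> (Y - X))"
  proof -
    have "W \<bullet> S = 2 * (S \<bullet> (mat 1 - transpose X ** Y))"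
      using inner_symmetric_part[OF symS] W by (metis inner_commute)
    moreover have "(X ** S) \<bullet> (Y - X) = S \<bullet> (transpose X ** Y - mat 1)"
      using X by (simp add: inner_matrix_mult_left matrix_mult_diff_right stiefel_def)
    ultimately show ?thesis
      by (simp add: inner_diff_right)
  qed
  moreover have "B - proj_tangent X B = (1 / 2) *\<^sub>R (X ** S)"
    by (simp add: proj_tangent_def S_def)
  ultimately show ?thesis
    by simp
qed

lemma weak_subgradient_inequality:
  assumes "G \<in> weak_subdifferential \<tau> h X"
  shows "h X + G \<bullet> (Y - X) - \<tau> / 2 * (norm (Y - X))\<^sup>2 \<le> h Y"
proof -
  obtain G' where G': "G' \<in> convex_subdifferential (\<lambda>Y. h Y + \<tau> / 2 * (norm Y)\<^sup>2) X"
    and G: "G = G' - \<tau> *\<^sub>R X"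
    using assms by (auto simp: weak_subdifferential_def)
  have "h X + \<tau> / 2 * (norm X)\<^sup>2 + G' \<bullet> (Y - X) \<le> h Y + \<tau> / 2 * (norm Y)\<^sup>2"
    using G' by (simp add: convex_subdifferential_def)
  moreover have "(norm Y)\<^sup>2 = (norm X)\<^sup>2 + (norm (Y - X))\<^sup>2 + 2 * (X \<bullet> (Y - X))"
    by (simp add: power2_norm_eq_inner inner_diff_left inner_diff_right inner_commute)
  moreover have "G \<bullet> (Y - X) = G' \<bullet> (Y - X) - \<tau> * (X \<bullet> (Y - X))"
    by (simp add: G inner_diff_left)
  ultimately show ?thesis
    by (simp add: algebra_simps)
qed

text \<open>
  Moving from \<open>X\<close> a small distance \<open>s\<close> in the direction of \<open>G\<close> raises \<open>h\<close> by at least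
  \<open>s |G| - \<tau> s\<^sup>2 / 2\<close> and by at most \<open>L s\<close>. For small \<open>s\<close> this is impossible if \<open>|G| > L\<close>.
\<close>

lemma norm_weak_subgradient_le:
  fixes X :: "'a :: real_inner"
  assumes G: "G \<in> weak_subdifferential \<tau> h X" and "0 \<le> \<tau>"
    and U: "open U" "X \<in> U" and lip: "L-lipschitz_on U h"
  shows "norm G \<le> L"
proof (rule ccontr)
  assume "\<not> norm G \<le> L"
  then have gL: "L < norm G" and "0 < norm G"
    using lipschitz_on_nonneg[OF lip] by linarith+
  obtain e where e: "0 < e" "ball X e \<subseteq> U"
    using U open_contains_ball by blast
  define s where "s = min (e / 2) ((norm G - L) / (\<tau> + 1))"
  have "0 < s" "s < e" "s \<le> (norm G - L) / (\<tau> + 1)"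
    using e gL \<open>0 \<le> \<tau>\<close> by (auto simp: s_def min_less_iff_disj)
  then have s: "0 < s" "s < e" "s * (\<tau> + 1) \<le> norm G - L"
    using \<open>0 \<le> \<tau>\<close> by (auto simp: pos_le_divide_eq)
  define Y where "Y = X + (s / norm G) *\<^sub>R G"
  have YX: "norm (Y - X) = s"
    using s \<open>0 < norm G\<close> by (simp add: Y_def)
  have "G \<bullet> (Y - X) = s * norm G"
    using \<open>0 < norm G\<close> by (simp add: Y_def field_simps power2_eq_square flip: power2_norm_eq_inner)
  then have "s * norm G - \<tau> / 2 * s\<^sup>2 \<le> h Y - h X"
    using weak_subgradient_inequality[OF G, of Y] by (simp add: YX)
  also have "\<dots> \<le> L * s"
  proof -
    have "Y \<in> U"
      using e s YX by (auto simp: dist_norm norm_minus_commute intro!: subsetD[OF e(2)])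
    then show ?thesis
      using lipschitz_onD[OF lip _ U(2), of Y] by (simp add: dist_norm YX)
  qed
  finally have "s * (norm G - L) \<le> s * (\<tau> / 2 * s)"
    by (simp add: algebra_simps power2_eq_square)
  then have "norm G - L \<le> \<tau> / 2 * s"
    using s by simp
  moreover have "0 \<le> \<tau> * s"
    using s \<open>0 \<le> \<tau>\<close> by simp
  ultimately show False
    using s by (simp add: algebra_simps)
qed

lemma riem_subgradient_inequality:
  fixes X Y :: "real ^ 'r ^ 'n"
  assumes g: "g \<in> riem_subdifferential \<tau> h X" and X: "X \<in> stiefel" and Y: "Y \<in> stiefel"
    and U: "open U" "X \<in> U" and lip: "L-lipschitz_on U h" and "0 \<le> \<tau>"
  shows "g \<in> tangent_space X" "norm g \<le> L"
    "h X + g \<bullet> (Y - X) - (L + \<tau>) / 2 * (norm (Y - X))\<^sup>2 \<le> h Y"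
proof -
  obtain G where G: "G \<in> weak_subdifferential \<tau> h X" and g: "g = proj_tangent X G"
    using g by (auto simp: riem_subdifferential_def)
  have GL: "norm G \<le> L"
    using norm_weak_subgradient_le[OF G \<open>0 \<le> \<tau>\<close> U lip] .
  show "g \<in> tangent_space X" "norm g \<le> L"
    using proj_tangent_in_tangent_space[OF X] norm_proj_tangent_le[OF X, of G] GL by (auto simp: g)
  have "norm G * (norm (Y - X))\<^sup>2 \<le> L * (norm (Y - X))\<^sup>2"
    using GL by (simp add: mult_right_mono)
  moreover have "(L + \<tau>) / 2 * (norm (Y - X))\<^sup>2
      = L * (norm (Y - X))\<^sup>2 / 2 + \<tau> / 2 * (norm (Y - X))\<^sup>2"
    by (simp add: field_simps)
  moreover have "g \<bullet> (Y - X) = G \<bullet> (Y - X) - (G - proj_tangent X G) \<bullet> (Y - X)"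
    by (simp add: g inner_diff_left)
  ultimately show "h X + g \<bullet> (Y - X) - (L + \<tau>) / 2 * (norm (Y - X))\<^sup>2 \<le> h Y"
    using proj_tangent_remainder[OF X Y, of G] weak_subgradient_inequality[OF G, of Y]
    by linarith
qed

section \<open>The Moreau envelope on the Stiefel manifold\<close>

lemma compact_stiefel: "compact (stiefel :: (real ^ 'r ^ 'n) set)"
  unfolding compact_eq_bounded_closed
proof
  have "norm X = sqrt (trace (mat 1 :: real ^ 'r ^ 'r))" if "X \<in> stiefel" for X :: "real ^ 'r ^ 'n"
    using that by (simp add: norm_matrix_eq_frobenius stiefel_def)
  then show "bounded (stiefel :: (real ^ 'r ^ 'n) set)"
    unfolding bounded_iff by (metis order_refl)
  show "closed (stiefel :: (real ^ 'r ^ 'n) set)"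
    unfolding stiefel_def
    by (intro closed_Collect_eq continuous_on_const continuous_on_id
        bounded_bilinear.continuous_on[OF bounded_bilinear_matrix_mult]
        bounded_linear.continuous_on[OF bounded_linear_transpose])
qed

lemma minimum_on_eqI:
  assumes "x \<in> S" and "\<And>y. y \<in> S \<Longrightarrow> h x \<le> h y"
  shows "minimum_on h S = h x"
  unfolding minimum_on_def using assms by (intro Least_equality) auto

lemma prox_map_in_stiefel:
  "is_prox_map lam F P \<Longrightarrow> X \<in> stiefel \<Longrightarrow> P X \<in> stiefel"
  by (simp add: is_prox_map_def is_arg_min_def)

lemma prox_map_minimal:
  "is_prox_map lam F P \<Longrightarrow> X \<in> stiefel \<Longrightarrow> Y \<in> stiefel \<Longrightarrow>
    prox_objective lam F X (P X) \<le> prox_objective lam F X Y"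
  by (metis is_prox_map_def is_arg_min_def not_le)

lemma moreau_envelope_eq_prox:
  assumes "is_prox_map lam F P" "X \<in> stiefel"
  shows "moreau_envelope lam F X = prox_objective lam F X (P X)"
  unfolding moreau_envelope_def
  using assms prox_map_in_stiefel prox_map_minimal by (intro minimum_on_eqI) blast+

lemma moreau_envelope_le:
  assumes "is_prox_map lam F P" "X \<in> stiefel" "Y \<in> stiefel"
  shows "moreau_envelope lam F X \<le> prox_objective lam F X Y"
  using assms by (simp add: moreau_envelope_eq_prox prox_map_minimal)

text \<open>
  The point is that the minimum exists: a minimiser of \<open>F\<close> over the compact Stiefel manifold also
  minimises the envelope, because \<open>moreau_envelope lam F Y \<le> F Y\<close> while every value of the
  envelope is at least the value of \<open>F\<close> at the proximal point.
\<close>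

lemma minimum_moreau_envelope_le:
  assumes P: "is_prox_map lam F P" and "0 < lam" and cont: "continuous_on stiefel F"
    and X: "X \<in> stiefel"
  shows "minimum_on (moreau_envelope lam F) stiefel \<le> moreau_envelope lam F X"
proof -
  obtain Ymin where Ymin: "Ymin \<in> stiefel" "\<And>Y. Y \<in> stiefel \<Longrightarrow> F Ymin \<le> F Y"
    using continuous_attains_inf[OF compact_stiefel _ cont] X by blast
  have least: "moreau_envelope lam F Ymin \<le> moreau_envelope lam F Z" if "Z \<in> stiefel" for Z
  proof -
    have "moreau_envelope lam F Ymin \<le> F Ymin"
      using moreau_envelope_le[OF P Ymin(1) Ymin(1)] by (simp add: prox_objective_def)
    also have "\<dots> \<le> F (P Z)"
      using Ymin prox_map_in_stiefel[OF P that] by blast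
    also have "\<dots> \<le> moreau_envelope lam F Z"
      using \<open>0 < lam\<close> by (simp add: moreau_envelope_eq_prox[OF P that] prox_objective_def)
    finally show ?thesis .
  qed
  have "minimum_on (moreau_envelope lam F) stiefel = moreau_envelope lam F Ymin"
    using Ymin(1) least by (rule minimum_on_eqI)
  also have "\<dots> \<le> moreau_envelope lam F X"
    using X by (rule least)
  finally show ?thesis .
qed

section \<open>One pass through the components\<close>

text \<open>
  Since the retraction brings the tangent step no farther from \<open>Y\<close>, it suffices to expand the square
  of the Euclidean step and to bound its linear term by the subgradient inequality.
\<close>

lemma riem_subgradient_step:
  fixes X Y :: "real ^ 'r ^ 'n"
  assumes g: "g \<in> riem_subdifferential \<tau> h X" and X: "X \<in> stiefel" and Y: "Y \<in> stiefel"
    and U: "open U" "stiefel \<subseteq> U" and lip: "L-lipschitz_on U h" and "0 \<le> \<tau>" and "0 < c"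
  defines "Z \<equiv> retr X (- c *\<^sub>R g)"
  shows "Z \<in> stiefel" "norm (Z - X) \<le> c * L"
    "(norm (Z - Y))\<^sup>2
      \<le> (norm (X - Y))\<^sup>2 + 2 * c * (h Y - h X) + c * (L + \<tau>) * (norm (X - Y))\<^sup>2 + c\<^sup>2 * L\<^sup>2"
proof -
  have "X \<in> U"
    using X U by blast
  note sub = riem_subgradient_inequality[OF g X Y U(1) this lip \<open>0 \<le> \<tau>\<close>]
  have tangent: "- c *\<^sub>R g \<in> tangent_space X"
  proof -
    have "transpose (- c *\<^sub>R g) ** X + transpose X ** (- c *\<^sub>R g)
        = (- c) *\<^sub>R (transpose g ** X + transpose X ** g)"
      by (simp only: transpose_scalar matrix_mult_scaleR_left matrix_mult_scaleR_right
          scaleR_add_right)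
    also have "\<dots> = 0"
      using sub(1) by (simp add: tangent_space_def)
    finally show ?thesis
      by (simp only: tangent_space_def mem_Collect_eq)
  qed
  show "Z \<in> stiefel"
    unfolding Z_def using retr_in_stiefel[OF X tangent] .
  have "norm (Z - X) \<le> norm (X + - c *\<^sub>R g - X)"
    unfolding Z_def using norm_retr_diff_le[OF X tangent X] .
  also have "\<dots> = c * norm g"
    using \<open>0 < c\<close> by simp
  also have "\<dots> \<le> c * L"
    using sub(2) \<open>0 < c\<close> by simp
  finally show "norm (Z - X) \<le> c * L" .
  have "(norm (Z - Y))\<^sup>2 \<le> (norm (X + - c *\<^sub>R g - Y))\<^sup>2"
    unfolding Z_def using norm_retr_diff_le[OF X tangent Y] by (rule power_mono) simp
  also have "\<dots> = (norm (X - Y))\<^sup>2 + 2 * c * (g \<bullet> (Y - X)) + c\<^sup>2 * (norm g)\<^sup>2"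
    unfolding power2_norm_eq_inner
    by (simp add: inner_add_left inner_add_right inner_diff_left inner_diff_right inner_commute
        algebra_simps power2_eq_square)
  also have "\<dots> \<le> (norm (X - Y))\<^sup>2 + 2 * c * (h Y - h X + (L + \<tau>) / 2 * (norm (X - Y))\<^sup>2)
      + c\<^sup>2 * L\<^sup>2"
    using sub(2,3) \<open>0 < c\<close>
    by (intro add_mono mult_left_mono power_mono order_refl) (auto simp: norm_minus_commute)
  also have "\<dots> = (norm (X - Y))\<^sup>2 + 2 * c * (h Y - h X) + c * (L + \<tau>) * (norm (X - Y))\<^sup>2
      + c\<^sup>2 * L\<^sup>2"
    by (simp add: field_simps)
  finally show "(norm (Z - Y))\<^sup>2
      \<le> (norm (X - Y))\<^sup>2 + 2 * c * (h Y - h X) + c * (L + \<tau>) * (norm (X - Y))\<^sup>2 + c\<^sup>2 * L\<^sup>2" .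
qed

lemma norm_diff_power2_le_twice:
  fixes a b c :: "'a :: real_inner"
  shows "(norm (a - c))\<^sup>2 \<le> 2 * (norm (b - c))\<^sup>2 + 2 * (norm (a - b))\<^sup>2"
proof -
  have "0 \<le> (norm ((b - c) - (a - b)))\<^sup>2"
    by simp
  also have "\<dots> = 2 * (norm (b - c))\<^sup>2 + 2 * (norm (a - b))\<^sup>2 - (norm (a - c))\<^sup>2"
    by (simp add: power2_norm_eq_inner inner_diff_left inner_diff_right inner_commute)
  finally show ?thesis
    by simp
qed

text \<open>
  A single step controls \<open>f i\<close> and the distance to \<open>Y\<close> at the current inner iterate, whereas the
  envelope argument needs both at the starting point \<open>Z 0\<close>. After \<open>j\<close> steps the drift is at most
  \<open>d = j c L\<close>. Lipschitz continuity changes the function term by \<open>2 c L d\<close>, which together with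
  \<open>c\<^sup>2 L\<^sup>2\<close> makes \<open>(c L)\<^sup>2 (2 j + 1)\<close>, the increment of \<open>(j c L)\<^sup>2\<close>. The distance term costs \<open>2 d\<^sup>2\<close>,
  and \<open>2 j\<^sup>2\<close> is the increment of \<open>C_const j\<close>.
\<close>

lemma incremental_pass:
  fixes Y :: "real ^ 'r ^ 'n"
  assumes Z0: "Z 0 \<in> stiefel" and Y: "Y \<in> stiefel"
    and g: "\<And>i. i \<in> {1..m} \<Longrightarrow> g i \<in> riem_subdifferential \<tau> (f i) (Z (i - 1))"
    and Z: "\<And>i. i \<in> {1..m} \<Longrightarrow> Z i = retr (Z (i - 1)) (- c *\<^sub>R g i)"
    and U: "open U" "stiefel \<subseteq> U" and lip: "\<And>i. i \<in> {1..m} \<Longrightarrow> L-lipschitz_on U (f i)"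
    and "0 \<le> \<tau>" and "0 < c" and "0 \<le> L" and "j \<le> m"
  shows "Z j \<in> stiefel \<and> norm (Z j - Z 0) \<le> real j * (c * L) \<and>
    (norm (Z j - Y))\<^sup>2 \<le> (norm (Z 0 - Y))\<^sup>2 + 2 * c * (\<Sum>i=1..j. f i Y - f i (Z 0))
      + 2 * real j * c * (L + \<tau>) * (norm (Z 0 - Y))\<^sup>2
      + (real j * c * L)\<^sup>2 + c ^ 3 * L\<^sup>2 * (L + \<tau>) * C_const j"
  using \<open>j \<le> m\<close>
proof (induction j)
  case 0
  show ?case
    using Z0 by (simp add: C_const_def)
next
  case (Suc j)
  define d where "d = real j * (c * L)"
  define N where "N = (norm (Z 0 - Y))\<^sup>2"
  have j: "Suc j \<in> {1..m}" "j \<le> m"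
    using Suc.prems by auto
  have Zj: "Z j \<in> stiefel" "norm (Z j - Z 0) \<le> d"
    and IH: "(norm (Z j - Y))\<^sup>2 \<le> N + 2 * c * (\<Sum>i=1..j. f i Y - f i (Z 0))
      + 2 * real j * c * (L + \<tau>) * N + (real j * c * L)\<^sup>2 + c ^ 3 * L\<^sup>2 * (L + \<tau>) * C_const j"
    using Suc.IH[OF j(2)] by (auto simp: d_def N_def)
  have g': "g (Suc j) \<in> riem_subdifferential \<tau> (f (Suc j)) (Z j)"
    and ZSuc: "Z (Suc j) = retr (Z j) (- c *\<^sub>R g (Suc j))"
    using g[OF j(1)] Z[OF j(1)] by simp_all
  note step = riem_subgradient_step[OF g' Zj(1) Y U lip[OF j(1)] \<open>0 \<le> \<tau>\<close> \<open>0 < c\<close>, folded ZSuc]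
  have "norm (Z (Suc j) - Z 0) \<le> norm (Z (Suc j) - Z j) + norm (Z j - Z 0)"
    using norm_triangle_ineq[of "Z (Suc j) - Z j" "Z j - Z 0"] by simp
  then have far: "norm (Z (Suc j) - Z 0) \<le> real (Suc j) * (c * L)"
    using step(2) Zj(2) by (simp add: d_def algebra_simps)
  have "f (Suc j) (Z 0) - f (Suc j) (Z j) \<le> L * norm (Z j - Z 0)"
    using lipschitz_onD[OF lip[OF j(1)] subsetD[OF U(2) Zj(1)] subsetD[OF U(2) Z0]]
    by (simp add: dist_norm)
  also have "\<dots> \<le> L * d"
    using Zj(2) \<open>0 \<le> L\<close> by (rule mult_left_mono)
  finally have "2 * c * (f (Suc j) Y - f (Suc j) (Z j))
      \<le> 2 * c * (f (Suc j) Y - f (Suc j) (Z 0) + L * d)"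
    using \<open>0 < c\<close> by simp
  moreover have "c * (L + \<tau>) * (norm (Z j - Y))\<^sup>2 \<le> c * (L + \<tau>) * (2 * N + 2 * d\<^sup>2)"
  proof -
    have "(norm (Z j - Z 0))\<^sup>2 \<le> d\<^sup>2"
      using Zj(2) by (rule power_mono) simp
    then have "(norm (Z j - Y))\<^sup>2 \<le> 2 * N + 2 * d\<^sup>2"
      using norm_diff_power2_le_twice[of "Z j" Y "Z 0"] by (simp add: N_def)
    then show ?thesis
      using \<open>0 < c\<close> \<open>0 \<le> L\<close> \<open>0 \<le> \<tau>\<close> by (intro mult_left_mono) simp_all
  qed
  ultimately have "(norm (Z (Suc j) - Y))\<^sup>2
      \<le> (N + 2 * c * (\<Sum>i=1..j. f i Y - f i (Z 0)) + 2 * real j * c * (L + \<tau>) * N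
          + (real j * c * L)\<^sup>2 + c ^ 3 * L\<^sup>2 * (L + \<tau>) * C_const j)
        + 2 * c * (f (Suc j) Y - f (Suc j) (Z 0) + L * d)
        + c * (L + \<tau>) * (2 * N + 2 * d\<^sup>2) + c\<^sup>2 * L\<^sup>2"
    using step(3) IH by linarith
  also have "\<dots> = N + 2 * c * (\<Sum>i=1..Suc j. f i Y - f i (Z 0))
      + 2 * real (Suc j) * c * (L + \<tau>) * N + (real (Suc j) * c * L)\<^sup>2
      + c ^ 3 * L\<^sup>2 * (L + \<tau>) * (C_const j + 2 * (real j)\<^sup>2)"
    by (simp add: d_def algebra_simps power2_eq_square power3_eq_cube)
  also have "C_const j + 2 * (real j)\<^sup>2 = C_const (Suc j)"
    by (simp add: C_const_def field_simps power2_eq_square)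
  finally show ?case
    using step(1) far by (simp add: N_def)
qed

text \<open>
  The proximal point \<open>Y\<close> of \<open>Z 0\<close> is admissible in the envelope at \<open>Z m\<close>, so the recursion for the
  distance to \<open>Y\<close> bounds the new envelope value. Minimality of \<open>Y\<close> against the competitor \<open>Z 0\<close>
  gives \<open>F Y - F (Z 0) \<le> - |Y - Z 0|\<^sup>2 / (2 lam)\<close>. In the coefficient of the decrease,
  the curvature term contributes \<open>L + \<tau>\<close> against this \<open>1 / (2 lam)\<close>.
\<close>

lemma moreau_envelope_descent:
  fixes Z :: "nat \<Rightarrow> real ^ 'r ^ 'n"
  assumes Z0: "Z 0 \<in> stiefel" and P: "is_prox_map lam F P" and F: "F = average m f" and "1 \<le> m"
    and g: "\<And>i. i \<in> {1..m} \<Longrightarrow> g i \<in> riem_subdifferential \<tau> (f i) (Z (i - 1))"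
    and Z: "\<And>i. i \<in> {1..m} \<Longrightarrow> Z i = retr (Z (i - 1)) (- c *\<^sub>R g i)"
    and U: "open U" "stiefel \<subseteq> U" and lip: "\<And>i. i \<in> {1..m} \<Longrightarrow> L-lipschitz_on U (f i)"
    and "0 \<le> \<tau>" and "0 < c" and "0 \<le> L" and "0 < lam"
  shows "moreau_envelope lam F (Z m) \<le> moreau_envelope lam F (Z 0)
    - lam * (1 / (2 * lam) - (L + \<tau>)) * (real m * c) * (stationarity lam P (Z 0))\<^sup>2
    + ((real m * c)\<^sup>2 * L\<^sup>2 + c ^ 3 * L\<^sup>2 * (L + \<tau>) * C_const m) / (2 * lam)"
proof -
  define Y where "Y = P (Z 0)"
  define N where "N = (norm (Z 0 - Y))\<^sup>2"
  define R where "R = (real m * c)\<^sup>2 * L\<^sup>2 + c ^ 3 * L\<^sup>2 * (L + \<tau>) * C_const m"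
  have Y: "Y \<in> stiefel"
    using prox_map_in_stiefel[OF P Z0] by (simp add: Y_def)
  have "Z m \<in> stiefel \<and> norm (Z m - Z 0) \<le> real m * (c * L) \<and>
    (norm (Z m - Y))\<^sup>2 \<le> (norm (Z 0 - Y))\<^sup>2 + 2 * c * (\<Sum>i=1..m. f i Y - f i (Z 0))
      + 2 * real m * c * (L + \<tau>) * (norm (Z 0 - Y))\<^sup>2
      + (real m * c * L)\<^sup>2 + c ^ 3 * L\<^sup>2 * (L + \<tau>) * C_const m"
    by (rule incremental_pass) (fact assms Y order_refl)+
  then have "Z m \<in> stiefel"
    and pass: "(norm (Z m - Y))\<^sup>2 \<le> N + 2 * c * (\<Sum>i=1..m. f i Y - f i (Z 0))
      + 2 * real m * c * (L + \<tau>) * N + R"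
    by (simp_all add: N_def R_def power_mult_distrib)
  have env0: "moreau_envelope lam F (Z 0) = F Y + N / (2 * lam)"
    using moreau_envelope_eq_prox[OF P Z0]
    by (simp add: prox_objective_def Y_def N_def norm_minus_commute)
  have "F Y - F (Z 0) \<le> - (N / (2 * lam))"
    using moreau_envelope_le[OF P Z0 Z0] env0 by (simp add: prox_objective_def)
  then have "real m * c * (F Y - F (Z 0)) \<le> real m * c * - (N / (2 * lam))"
    using \<open>0 < c\<close> by (intro mult_left_mono) simp_all
  moreover have "2 * c * (\<Sum>i=1..m. f i Y - f i (Z 0)) = 2 * (real m * c * (F Y - F (Z 0)))"
    using \<open>1 \<le> m\<close> by (simp add: F average_def sum_subtractf field_simps)
  ultimately have "(norm (Z m - Y))\<^sup>2
      \<le> N + 2 * (real m * c * - (N / (2 * lam))) + 2 * real m * c * (L + \<tau>) * N + R"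
    using pass by linarith
  also have "\<dots> = N - 2 * (1 / (2 * lam) - (L + \<tau>)) * (real m * c) * N + R"
    by (simp add: algebra_simps)
  finally have "(norm (Z m - Y))\<^sup>2 / (2 * lam)
      \<le> (N - 2 * (1 / (2 * lam) - (L + \<tau>)) * (real m * c) * N + R) / (2 * lam)"
    using \<open>0 < lam\<close> by (simp add: divide_right_mono)
  moreover have "moreau_envelope lam F (Z m) \<le> F Y + (norm (Z m - Y))\<^sup>2 / (2 * lam)"
    using moreau_envelope_le[OF P \<open>Z m \<in> stiefel\<close> Y]
    by (simp add: prox_objective_def norm_minus_commute)
  moreover have N_eq: "N = lam\<^sup>2 * (stationarity lam P (Z 0))\<^sup>2"
    using \<open>0 < lam\<close> by (simp add: stationarity_def N_def Y_def power_divide norm_minus_commute)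
  ultimately have "moreau_envelope lam F (Z m) \<le> moreau_envelope lam F (Z 0)
      - (2 * (1 / (2 * lam) - (L + \<tau>)) * (real m * c) * N - R) / (2 * lam)"
    by (simp add: env0 diff_divide_distrib add_divide_distrib)
  also have "(2 * (1 / (2 * lam) - (L + \<tau>)) * (real m * c) * N - R) / (2 * lam)
      = lam * (1 / (2 * lam) - (L + \<tau>)) * (real m * c) * (stationarity lam P (Z 0))\<^sup>2
        - R / (2 * lam)"
    unfolding N_eq using \<open>0 < lam\<close>
    by (simp add: diff_divide_distrib power2_eq_square)
  finally show ?thesis
    by (simp add: R_def)
qed

section \<open>Summing the descent inequalities\<close>

lemma Min_le_of_telescoped_descent:
  fixes e \<theta> s b :: "nat \<Rightarrow> real"
  assumes desc: "\<And>k. e (Suc k) \<le> e k - \<kappa> * s k * \<theta> k + b k"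
    and lower: "\<And>k. E \<le> e k" and "0 < \<kappa>" and s: "\<And>k. 0 \<le> s k" and \<theta>: "\<And>k. 0 \<le> \<theta> k"
    and sum_s: "S \<le> (\<Sum>k\<le>T. s k)" and "0 < S" and sum_b: "(\<Sum>k\<le>T. b k) \<le> B"
  shows "Min (\<theta> ` {0..T}) \<le> (e 0 - E + B) / (\<kappa> * S)"
proof -
  let ?\<mu> = "Min (\<theta> ` {0..T})"
  have \<mu>: "?\<mu> \<le> \<theta> k" if "k \<le> T" for k
    using that by (intro Min_le) auto
  have "0 \<le> ?\<mu>"
    using \<theta> by simp
  have "e (Suc n) \<le> e 0 - (\<Sum>k\<le>n. \<kappa> * s k * \<theta> k) + (\<Sum>k\<le>n. b k)" for n
  proof (induction n)
    case (Suc n)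
    then show ?case
      using desc[of "Suc n"] by simp
  qed (use desc[of 0] in simp)
  then have "(\<Sum>k\<le>T. \<kappa> * s k * \<theta> k) \<le> e 0 - E + B"
    using lower[of "Suc T"] sum_b by (smt (verit))
  moreover have "?\<mu> * (\<kappa> * S) \<le> (\<Sum>k\<le>T. \<kappa> * s k * \<theta> k)"
  proof -
    have "?\<mu> * (\<kappa> * S) \<le> ?\<mu> * (\<kappa> * (\<Sum>k\<le>T. s k))"
      using \<open>0 \<le> ?\<mu>\<close> \<open>0 < \<kappa>\<close> sum_s by (intro mult_left_mono) simp_all
    also have "\<dots> = (\<Sum>k\<le>T. \<kappa> * s k * ?\<mu>)"
      by (simp add: sum_distrib_left sum_distrib_right mult_ac)
    also have "\<dots> \<le> (\<Sum>k\<le>T. \<kappa> * s k * \<theta> k)"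
      using s \<open>0 < \<kappa>\<close> \<mu> by (intro sum_mono mult_left_mono) simp_all
    finally show ?thesis .
  qed
  ultimately show ?thesis
    using \<open>0 < \<kappa>\<close> \<open>0 < S\<close> by (simp add: pos_le_divide_eq)
qed

text \<open>
  The harmonic sums minus the logarithm decrease from their first value, which is \<open>1\<close>.
\<close>

lemma sum_inverse_le_ln: "(\<Sum>k\<le>T. 1 / (real k + 1)) \<le> ln (real T + 1) + 1"
proof -
  have "harm (Suc T) - ln (real (Suc T)) \<le> harm (Suc 0) - ln (real (Suc 0))"
    using decseqD[OF decseq_harm_diff_ln, of 0 T] by simp
  moreover have "(\<Sum>k\<le>T. 1 / (real k + 1)) = harm (Suc T)"
    by (simp add: harm_altdef lessThan_Suc_atMost inverse_eq_divide add.commute)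
  ultimately show ?thesis
    by (simp add: harm_Suc harm_def[of 0] add.commute)
qed

lemma sqrt_le_sum_inverse_sqrt: "sqrt (real T + 1) \<le> (\<Sum>k\<le>T. 1 / sqrt (real k + 1))"
proof -
  have "sqrt (real T + 1) = (\<Sum>k\<le>T. 1 / sqrt (real T + 1))"
    by (simp add: real_div_sqrt add.commute)
  also have "\<dots> \<le> (\<Sum>k\<le>T. 1 / sqrt (real k + 1))"
    by (intro sum_mono divide_left_mono) simp_all
  finally show ?thesis .
qed

text \<open>
  Both stepsize rules are instances, with \<open>s k = m \<gamma> k\<close>. Since \<open>s k \<le> 1\<close>, the cubic error term is
  dominated by the quadratic one, so that a single bound \<open>A\<close> on \<open>\<Sum> s k\<^sup>2\<close> controls all errors.
\<close>

lemma stationarity_rate: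
  fixes X :: "nat \<Rightarrow> real ^ 'r ^ 'n" and f :: "nat \<Rightarrow> real ^ 'r ^ 'n \<Rightarrow> real"
  assumes "1 \<le> m" and "0 \<le> \<tau>" and F: "F = average m f"
    and U: "open U" "stiefel \<subseteq> U" and "0 < L"
    and lip: "\<And>i. i \<in> {1..m} \<Longrightarrow> L-lipschitz_on U (f i)"
    and lam: "0 < lam" "lam < 1 / (2 * (L + \<tau>))" and P: "is_prox_map lam F P"
    and X: "riem_incremental_subgradient \<tau> m f \<gamma> X"
    and \<gamma>: "\<And>k. \<gamma> k = s k / real m" and s: "\<And>k. s k \<le> 1"
    and sum_s: "sqrt (real T + 1) \<le> (\<Sum>k\<le>T. s k)" and sum_s2: "(\<Sum>k\<le>T. (s k)\<^sup>2) \<le> A"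
  shows "Min ((\<lambda>k. (stationarity lam P (X k))\<^sup>2) ` {0..T})
    \<le> (2 * (moreau_envelope lam F (X 0) - minimum_on (moreau_envelope lam F) stiefel)
        + (L\<^sup>2 / lam + L\<^sup>2 * (L + \<tau>) / (lam * real m ^ 3) * C_const m) * A)
      / (2 * lam * (1 / (2 * lam) - (L + \<tau>)) * sqrt (real T + 1))"
proof -
  define E where "E = minimum_on (moreau_envelope lam F) stiefel"
  define \<kappa> where "\<kappa> = lam * (1 / (2 * lam) - (L + \<tau>))"
  define Q where "Q = L\<^sup>2 / lam + L\<^sup>2 * (L + \<tau>) / (lam * real m ^ 3) * C_const m"
  have "0 < L + \<tau>"
    using \<open>0 < L\<close> \<open>0 \<le> \<tau>\<close> by simp
  then have "L + \<tau> < 1 / (2 * lam)"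
    using lam by (simp add: field_simps)
  then have "0 < \<kappa>"
    using lam by (simp add: \<kappa>_def)
  have "0 \<le> C_const m"
    using \<open>1 \<le> m\<close> by (simp add: C_const_def)
  obtain Z G where X0: "X 0 \<in> stiefel" and \<gamma>_pos: "\<And>k. 0 < \<gamma> k"
    and Z: "\<And>k. Z k 0 = X k" "\<And>k. X (Suc k) = Z k m"
      "\<And>k i. i \<in> {1..m} \<Longrightarrow> G k i \<in> riem_subdifferential \<tau> (f i) (Z k (i - 1))"
      "\<And>k i. i \<in> {1..m} \<Longrightarrow> Z k i = retr (Z k (i - 1)) (- \<gamma> k *\<^sub>R G k i)"
    using X unfolding riem_incremental_subgradient_def by blast
  have s_pos: "0 < s k" for k
    using \<gamma>_pos[of k] \<open>1 \<le> m\<close> by (simp add: \<gamma> zero_less_divide_iff)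
  have X_stiefel: "X k \<in> stiefel" for k
  proof (induction k)
    case (Suc k)
    then have "Z k 0 \<in> stiefel"
      by (simp add: Z)
    then have "Z k m \<in> stiefel"
      by (rule incremental_pass[where Y = "Z k 0" and g = "G k" and f = f and U = U, THEN conjunct1])
        (fact assms Z \<gamma>_pos \<open>Z k 0 \<in> stiefel\<close> less_imp_le[OF \<open>0 < L\<close>] order_refl)+
    then show ?case
      by (simp add: Z)
  qed (fact X0)
  have "continuous_on stiefel F"
    unfolding F average_def using lip U(2)
    by (intro continuous_intros) (meson continuous_on_subset lipschitz_on_continuous_on)
  then have lower: "E \<le> moreau_envelope lam F (X k)" for k
    unfolding E_def using minimum_moreau_envelope_le[OF P lam(1) _ X_stiefel] by blast
  have "moreau_envelope lam F (X (Suc k)) \<le> moreau_envelope lam F (X k)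
      - \<kappa> * s k * (stationarity lam P (X k))\<^sup>2 + Q / 2 * (s k)\<^sup>2" for k
  proof -
    have "Z k 0 \<in> stiefel"
      by (simp add: Z X_stiefel)
    then have "moreau_envelope lam F (Z k m) \<le> moreau_envelope lam F (Z k 0)
      - lam * (1 / (2 * lam) - (L + \<tau>)) * (real m * \<gamma> k) * (stationarity lam P (Z k 0))\<^sup>2
      + ((real m * \<gamma> k)\<^sup>2 * L\<^sup>2 + \<gamma> k ^ 3 * L\<^sup>2 * (L + \<tau>) * C_const m) / (2 * lam)"
      by (rule moreau_envelope_descent[where g = "G k" and U = U])
        (fact assms Z \<gamma>_pos less_imp_le[OF \<open>0 < L\<close>])+
    moreover have "real m * \<gamma> k = s k"
      using \<open>1 \<le> m\<close> by (simp add: \<gamma>)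
    moreover have "((s k)\<^sup>2 * L\<^sup>2 + \<gamma> k ^ 3 * L\<^sup>2 * (L + \<tau>) * C_const m) / (2 * lam)
        \<le> Q / 2 * (s k)\<^sup>2"
    proof -
      have "\<gamma> k ^ 3 \<le> (s k)\<^sup>2 / real m ^ 3"
      proof -
        have "s k ^ 3 \<le> (s k)\<^sup>2"
          using s[of k] s_pos[of k] by (intro power_decreasing) simp_all
        then show ?thesis
          by (simp add: \<gamma> power_divide divide_right_mono)
      qed
      then have "\<gamma> k ^ 3 * (L\<^sup>2 * (L + \<tau>) * C_const m)
          \<le> (s k)\<^sup>2 / real m ^ 3 * (L\<^sup>2 * (L + \<tau>) * C_const m)"
        using \<open>0 < L + \<tau>\<close> \<open>0 \<le> C_const m\<close> by (intro mult_right_mono) simp_all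
      then have "((s k)\<^sup>2 * L\<^sup>2 + \<gamma> k ^ 3 * L\<^sup>2 * (L + \<tau>) * C_const m) / (2 * lam)
          \<le> ((s k)\<^sup>2 * L\<^sup>2 + (s k)\<^sup>2 / real m ^ 3 * (L\<^sup>2 * (L + \<tau>) * C_const m)) / (2 * lam)"
        using lam by (intro divide_right_mono) (simp_all add: mult.assoc)
      also have "\<dots> = Q / 2 * (s k)\<^sup>2"
        using lam \<open>1 \<le> m\<close> by (simp add: Q_def field_simps)
      finally show ?thesis .
    qed
    ultimately show ?thesis
      by (simp only: Z \<kappa>_def)
  qed
  moreover have "(\<Sum>k\<le>T. Q / 2 * (s k)\<^sup>2) \<le> Q / 2 * A"
  proof -
    have "0 \<le> Q"
      using lam \<open>0 < L + \<tau>\<close> \<open>0 \<le> C_const m\<close> by (simp add: Q_def)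
    then show ?thesis
      unfolding sum_distrib_left[symmetric] using sum_s2 by (intro mult_left_mono) simp_all
  qed
  ultimately have "Min ((\<lambda>k. (stationarity lam P (X k))\<^sup>2) ` {0..T})
      \<le> (moreau_envelope lam F (X 0) - E + Q / 2 * A) / (\<kappa> * sqrt (real T + 1))"
    using lower \<open>0 < \<kappa>\<close> s_pos sum_s
    by (intro Min_le_of_telescoped_descent) (auto simp: less_imp_le)
  also have "\<dots> = (2 * (moreau_envelope lam F (X 0) - E + Q / 2 * A))
      / (2 * (\<kappa> * sqrt (real T + 1)))"
    by (rule mult_divide_mult_cancel_left[symmetric]) simp
  also have "\<dots> = (2 * (moreau_envelope lam F (X 0) - E) + Q * A)
      / (2 * lam * (1 / (2 * lam) - (L + \<tau>)) * sqrt (real T + 1))"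
    by (rule arg_cong2[where f = "(/)"]) (simp_all add: \<kappa>_def algebra_simps)
  finally show ?thesis
    by (simp only: E_def Q_def)
qed

theorem theorem2:
  fixes f :: "nat \<Rightarrow> real ^ 'r ^ 'n \<Rightarrow> real"
    and F :: "real ^ 'r ^ 'n \<Rightarrow> real"
    and m :: nat
    and \<tau> L lam :: real
    and U :: "(real ^ 'r ^ 'n) set"
    and P :: "real ^ 'r ^ 'n \<Rightarrow> real ^ 'r ^ 'n"
    and \<gamma> :: "nat \<Rightarrow> real"
    and X :: "nat \<Rightarrow> real ^ 'r ^ 'n"
  assumes "m \<ge> 1" and "\<tau> \<ge> 0"
    and "\<And>i. i \<in> {1..m} \<Longrightarrow> weakly_convex \<tau> (f i)"
    and "F = average m f"
    and "bounded U" and "open U" and "convex U" and "stiefel \<subseteq> U"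
    and "L > 0" and "\<And>i. i \<in> {1..m} \<Longrightarrow> L-lipschitz_on U (f i)"
    and "0 < lam" and "lam < 1 / (2 * (L + \<tau>))"
    and "is_prox_map lam F P"
    and "riem_incremental_subgradient \<tau> m f \<gamma> X"
  shows
    "(\<forall>T::nat. (\<forall>k. \<gamma> k = 1 / (real m * sqrt (real T + 1))) \<longrightarrow>
        Min ((\<lambda>k. (stationarity lam P (X k))\<^sup>2) ` {0..T})
          \<le> (2 * (moreau_envelope lam F (X 0) - minimum_on (moreau_envelope lam F) stiefel)
               + L\<^sup>2 / lam + L\<^sup>2 * (L + \<tau>) / (lam * real m ^ 3) * C_const m)
             / (2 * lam * (1 / (2 * lam) - (L + \<tau>)) * sqrt (real T + 1)))
     \<and> ((\<forall>k. \<gamma> k = 1 / (real m * sqrt (real k + 1))) \<longrightarrow>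
        (\<forall>T::nat. Min ((\<lambda>k. (stationarity lam P (X k))\<^sup>2) ` {0..T})
          \<le> (2 * (moreau_envelope lam F (X 0) - minimum_on (moreau_envelope lam F) stiefel)
               + (L\<^sup>2 / lam + L\<^sup>2 * (L + \<tau>) / (lam * real m ^ 3) * C_const m)
                 * (ln (real T + 1) + 1))
             / (2 * lam * (1 / (2 * lam) - (L + \<tau>)) * sqrt (real T + 1))))"
proof (intro conjI allI impI)
  have U: "open U" "stiefel \<subseteq> U" and L: "0 < L" and lam: "0 < lam" "lam < 1 / (2 * (L + \<tau>))"
    and m: "1 \<le> m"
    using assms by simp_all
  note rate = stationarity_rate[OF m \<open>\<tau> \<ge> 0\<close> \<open>F = average m f\<close> U L
      \<open>\<And>i. i \<in> {1..m} \<Longrightarrow> L-lipschitz_on U (f i)\<close> lam \<open>is_prox_map lam F P\<close>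
      \<open>riem_incremental_subgradient \<tau> m f \<gamma> X\<close>]
  {
    fix T :: nat
    assume "\<forall>k. \<gamma> k = 1 / (real m * sqrt (real T + 1))"
    then have \<gamma>: "\<gamma> k = 1 / sqrt (real T + 1) / real m" for k
      by (simp add: mult.commute)
    have "sqrt (real T + 1) \<le> (\<Sum>k\<le>T. 1 / sqrt (real T + 1))"
      by (simp add: real_div_sqrt add.commute)
    moreover have "(\<Sum>k\<le>T. (1 / sqrt (real T + 1))\<^sup>2) \<le> 1"
      by (simp add: power_divide field_simps)
    ultimately show "Min ((\<lambda>k. (stationarity lam P (X k))\<^sup>2) ` {0..T})
          \<le> (2 * (moreau_envelope lam F (X 0) - minimum_on (moreau_envelope lam F) stiefel)
               + L\<^sup>2 / lam + L\<^sup>2 * (L + \<tau>) / (lam * real m ^ 3) * C_const m)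
             / (2 * lam * (1 / (2 * lam) - (L + \<tau>)) * sqrt (real T + 1))"
      using rate[OF _ \<gamma>, of T 1] by (simp add: add.assoc)
  }
  {
    fix T :: nat
    assume "\<forall>k. \<gamma> k = 1 / (real m * sqrt (real k + 1))"
    then have \<gamma>: "\<gamma> k = 1 / sqrt (real k + 1) / real m" for k
      by (simp add: mult.commute)
    have "(\<Sum>k\<le>T. (1 / sqrt (real k + 1))\<^sup>2) \<le> ln (real T + 1) + 1"
      using sum_inverse_le_ln[of T] by (simp add: power_divide)
    then show "Min ((\<lambda>k. (stationarity lam P (X k))\<^sup>2) ` {0..T})
          \<le> (2 * (moreau_envelope lam F (X 0) - minimum_on (moreau_envelope lam F) stiefel)
               + (L\<^sup>2 / lam + L\<^sup>2 * (L + \<tau>) / (lam * real m ^ 3) * C_const m)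
                 * (ln (real T + 1) + 1))
             / (2 * lam * (1 / (2 * lam) - (L + \<tau>)) * sqrt (real T + 1))"
      using sqrt_le_sum_inverse_sqrt[of T] by (intro rate[OF _ \<gamma>]) simp_all
  }
qed

end
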